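(* Let $\kappa>0$ be a real number, let $\Phi$ be the standard normal distribution function, and define $$g_{\kappa}(x):=\Phi\left(\sqrt{\tfrac{1}{\kappa}}(\kappa-1)x\right)+e^{2x^2}\,\Phi\left(-\sqrt{\tfrac{1}{\kappa}}(\kappa+1)x\right),\quad x\in(0,\infty).$$ (i) If $\kappa\leq 1$, then $$\inf_{x\in(0,\infty)}g_{\kappa}(x)=\lim_{x\to\infty}g_{\kappa}(x)=\begin{cases}0,&\text{if }\kappa<1,\\ \frac12,&\text{if }\kappa=1.\end{cases}$$ (ii) If $\kappa>1$, then the function $$h_{\kappa}(x):=2\int_{\sqrt{\frac{1}{\kappa}}(\kappa+1)x}^{\infty}\exp\left(-\tfrac12 t^2\right)dt-\sqrt{\tfrac{1}{\kappa}}\,\frac{\exp\left(-\frac{(\kappa+1)^2}{2\kappa}x^2\right)}{x},\quad x\in(0,\infty),$$ has a unique zero $x_0(\kappa)$ in $(0,\infty)$, and $g_{\kappa}$ attains its minimum over $(0,\infty)$ at this point: $$\min_{x\in(0,\infty)}g_{\kappa}(x)=g_{\kappa}(x_0(\kappa)).$$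
   Context: $\Phi(z)=\frac{1}{\sqrt{2\pi}}\int_{-\infty}^{z}e^{-t^2/2}\,dt$ is the distribution function of the standard normal distribution. Origin of $g_\kappa$: if $X_{\mu,\lambda}$ is an inverse Gaussian random variable with parameters $\mu>0,\lambda>0$, i.e. with density $\sqrt{\frac{\lambda}{2\pi x^3}}\exp\left(-\frac{\lambda(x-\mu)^2}{2\mu^2x}\right)$ for $x>0$, whose expectation is $\mu$, then $P(X_{\mu,\lambda}\leq\kappa E[X_{\mu,\lambda}])=g_\kappa\left(\sqrt{\lambda/\mu}\right)$. *)

theory Defs
  imports "HOL-Probability.Probability"
begin

definition Phi :: "real \<Rightarrow> real" where
  "Phi z = 1 / sqrt (2 * pi) * (LBINT t:{..z}. exp (- t\<^sup>2 / 2))"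

lemma Phi_eq_cdf: "Phi = cdf std_normal_distribution"
proof
  fix z :: real
  have eq: "indicator {..z} t *\<^sub>R std_normal_density t
      = 1 / sqrt (2 * pi) * (indicator {..z} t *\<^sub>R exp (- t\<^sup>2 / 2))" for t
    by (simp add: std_normal_density_def)
  have int: "set_integrable lborel {..z} std_normal_density"
    unfolding set_integrable_def
    by (rule integrable_mult_indicator) auto
  have "emeasure std_normal_distribution {..z}
      = (\<integral>\<^sup>+t. ennreal (indicator {..z} t *\<^sub>R std_normal_density t) \<partial>lborel)"
    by (subst emeasure_density)
       (auto intro!: nn_integral_cong simp: indicator_def normal_density_nonneg)
  also have "\<dots> = ennreal (LBINT t:{..z}. std_normal_density t)"
    using int unfolding set_integrable_def set_lebesgue_integral_def
    by (intro nn_integral_eq_integral) (auto simp: indicator_def)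
  finally have "cdf std_normal_distribution z = (LBINT t:{..z}. std_normal_density t)"
    unfolding cdf_def
    by (simp add: measure_def set_lebesgue_integral_def indicator_def)
  also have "\<dots> = Phi z"
    unfolding Phi_def set_lebesgue_integral_def eq by simp
  finally show "Phi z = cdf std_normal_distribution z" ..
qed

definition g_kappa :: "real \<Rightarrow> real \<Rightarrow> real" where
  "g_kappa \<kappa> x = Phi (sqrt (1 / \<kappa>) * (\<kappa> - 1) * x)
     + exp (2 * x\<^sup>2) * Phi (- (sqrt (1 / \<kappa>) * (\<kappa> + 1) * x))"

definition h_kappa :: "real \<Rightarrow> real \<Rightarrow> real" where
  "h_kappa \<kappa> x = 2 * (LBINT t:{sqrt (1 / \<kappa>) * (\<kappa> + 1) * x..}. exp (- (1 / 2) * t\<^sup>2))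
     - sqrt (1 / \<kappa>) * (exp (- ((\<kappa> + 1)\<^sup>2 / (2 * \<kappa>)) * x\<^sup>2) / x)"

end

theory Submission
  imports Defs
begin

text \<open>
  Write \<open>s = sqrt (1/\<kappa>)\<close>, \<open>a = s(\<kappa> - 1)\<close> and \<open>b = s(\<kappa> + 1)\<close>. Since \<open>b\<^sup>2 = a\<^sup>2 + 4\<close> and
  \<open>a - b = -2s\<close>, differentiating shows that \<open>g_kappa \<kappa>\<close> has derivative
  \<open>2 x exp (2 x\<^sup>2) / sqrt (2 pi)\<close> times \<open>h_kappa \<kappa>\<close>, so the sign of \<open>h_kappa \<kappa>\<close> decides where
  \<open>g_kappa \<kappa>\<close> increases. The derivative of \<open>h_kappa \<kappa>\<close> has the sign of \<open>s/x\<^sup>2 - b(1 - 1/\<kappa>)\<close>, and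
  \<open>h_kappa \<kappa>\<close> vanishes at infinity. For \<open>\<kappa> \<le> 1\<close> it therefore increases to \<open>0\<close> and is negative;
  this negativity also bounds the second summand of \<open>g_kappa \<kappa>\<close> by a multiple of \<open>1/x\<close>.
  For \<open>\<kappa> > 1\<close> it increases from minus infinity up to a point \<open>c\<close> and then decreases to \<open>0\<close>, hence
  changes sign exactly once, from negative to positive.
\<close>

section \<open>Monotone functions and limits at infinity\<close>

text \<open>A strictly increasing function stays strictly below its limit. Positivity is asked for
  only beyond \<open>x\<close>, so \<open>x\<close> may itself be a critical point of
  \<open>f\<close>.\<close>

lemma deriv_pos_tendsto_imp_less:
  fixes f f' :: "real \<Rightarrow> real"
  assumes deriv: "\<And>y. x \<le> y \<Longrightarrow> (f has_real_derivative f' y) (at y)"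
    and pos: "\<And>y. x < y \<Longrightarrow> 0 < f' y"
    and lim: "(f \<longlongrightarrow> L) at_top"
  shows "f x < L"
proof -
  have incr: "f u < f v" if "x \<le> u" "u < v" for u v
  proof (rule DERIV_pos_imp_increasing_open[OF \<open>u < v\<close>])
    show "\<exists>D. (f has_real_derivative D) (at y) \<and> 0 < D" if "u < y" "y < v" for y
      using that \<open>x \<le> u\<close> deriv[of y] pos[of y] by auto
    show "continuous_on {u..v} f"
      using \<open>x \<le> u\<close> by (intro continuous_at_imp_continuous_on ballI DERIV_isCont[OF deriv]) auto
  qed
  \<comment> \<open>Passing to the limit gives only a weak inequality; starting one unit further
    right leaves room for the strict one.\<close>
  have "f (x + 1) \<le> L"
  proof (rule tendsto_lowerbound[OF lim])
    show "\<forall>\<^sub>F y in at_top. f (x + 1) \<le> f y"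
      using eventually_gt_at_top[of "x + 1"] by eventually_elim (auto intro!: less_imp_le incr)
  qed simp
  moreover have "f x < f (x + 1)" by (rule incr) auto
  ultimately show ?thesis by simp
qed

text \<open>A decreasing function lies above its limit, and any lower bound of its values is also a
  lower bound of the limit. Boundedness is recorded because a real infimum is meaningful only for
  sets bounded below.\<close>

lemma INF_eq_limit_at_top:
  fixes f :: "real \<Rightarrow> real"
  assumes decr: "\<And>x y. 0 < x \<Longrightarrow> x < y \<Longrightarrow> f y \<le> f x"
    and lim: "(f \<longlongrightarrow> L) at_top"
  shows "bdd_below (f ` {0<..})" and "(INF x\<in>{0<..}. f x) = L"
proof -
  have ge: "L \<le> f x" if "0 < x" for x
  proof (rule tendsto_upperbound[OF lim])
    show "\<forall>\<^sub>F y in at_top. f y \<le> f x"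
      using eventually_gt_at_top[of x] by eventually_elim (use decr that in auto)
  qed simp
  then show bdd: "bdd_below (f ` {0<..})" by (auto intro!: bdd_belowI2)
  have "(INF x\<in>{0<..}. f x) \<le> L"
  proof (rule tendsto_lowerbound[OF lim])
    show "\<forall>\<^sub>F y in at_top. (INF x\<in>{0<..}. f x) \<le> f y"
      using eventually_gt_at_top[of 0] by eventually_elim (auto intro!: cINF_lower bdd)
  qed simp
  moreover have "L \<le> (INF x\<in>{0<..}. f x)"
    by (rule cINF_greatest) (use ge in \<open>auto intro: greaterThan_non_empty\<close>)
  ultimately show "(INF x\<in>{0<..}. f x) = L" by simp
qed

section \<open>The standard normal distribution function\<close>

lemma set_integrable_gaussian:
  assumes "A \<in> sets borel"
  shows "set_integrable lborel A (\<lambda>t::real. exp (- t\<^sup>2 / 2))"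
proof -
  have "set_integrable lborel A (\<lambda>t. sqrt (2 * pi) * std_normal_density t)"
    unfolding set_integrable_def by (rule integrable_mult_indicator) (use assms in auto)
  then show ?thesis by (simp add: std_normal_density_def)
qed

lemma Phi_bounds: "0 \<le> Phi z" "Phi z \<le> 1"
proof -
  interpret real_distribution std_normal_distribution by (rule real_dist_normal_dist)
  show "0 \<le> Phi z" "Phi z \<le> 1" unfolding Phi_eq_cdf by (simp_all add: cdf_nonneg cdf_bounded_prob)
qed

lemma Phi_at_bot: "(Phi \<longlongrightarrow> 0) at_bot"
proof -
  interpret real_distribution std_normal_distribution by (rule real_dist_normal_dist)
  show ?thesis unfolding Phi_eq_cdf by (rule cdf_lim_at_bot)
qed

lemma Phi_at_top: "(Phi \<longlongrightarrow> 1) at_top"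
proof -
  interpret real_distribution std_normal_distribution by (rule real_dist_normal_dist)
  show ?thesis unfolding Phi_eq_cdf by (rule cdf_lim_at_top_prob)
qed

text \<open>Splitting the half-line at \<open>z - 1\<close> leaves a constant plus an integral over
  a bounded interval, to which the fundamental theorem of calculus applies with \<open>z\<close> as
  an interior point.\<close>

lemma DERIV_Phi: "(Phi has_real_derivative exp (- z\<^sup>2 / 2) / sqrt (2 * pi)) (at z)"
proof -
  define I where "I u = (LBINT t=ereal (z - 1)..ereal u. exp (- t\<^sup>2 / 2))" for u
  have Phi_I: "Phi u = Phi (z - 1) + 1 / sqrt (2 * pi) * I u" if "z - 1 < u" for u
  proof -
    have "{..u} = {..z - 1} \<union> {z - 1<..u}" using that by auto
    then have "(LBINT t:{..u}. exp (- t\<^sup>2 / 2))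
        = (LBINT t:{..z - 1}. exp (- t\<^sup>2 / 2)) + (LBINT t:{z - 1<..u}. exp (- t\<^sup>2 / 2))"
      by (simp only:, intro set_integral_Un set_integrable_gaussian) auto
    also have "(LBINT t:{z - 1<..u}. exp (- t\<^sup>2 / 2)) = I u"
      unfolding I_def using that by (subst interval_integral_Ioc) auto
    finally show ?thesis by (simp add: Phi_def distrib_left)
  qed
  have "(I has_vector_derivative exp (- z\<^sup>2 / 2)) (at z within {z - 1..z + 1})"
    unfolding I_def by (rule interval_integral_FTC2) (auto intro!: continuous_intros)
  then have "(I has_real_derivative exp (- z\<^sup>2 / 2)) (at z)"
    by (simp add: has_real_derivative_iff_has_vector_derivative at_within_Icc_at)
  then have "((\<lambda>u. Phi (z - 1) + 1 / sqrt (2 * pi) * I u) has_real_derivative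
      0 + 1 / sqrt (2 * pi) * exp (- z\<^sup>2 / 2)) (at z)"
    by (intro DERIV_add DERIV_const DERIV_cmult)
  then have "(Phi has_real_derivative 0 + 1 / sqrt (2 * pi) * exp (- z\<^sup>2 / 2)) (at z)"
    by (rule has_field_derivative_transform_within_open[of _ _ _ "{z - 1<..}"]) (auto simp: Phi_I)
  then show ?thesis by simp
qed

lemma DERIV_Phi_chain [derivative_intros]:
  assumes "(f has_real_derivative f') (at x within S)"
  shows "((\<lambda>x. Phi (f x)) has_real_derivative exp (- (f x)\<^sup>2 / 2) / sqrt (2 * pi) * f')
    (at x within S)"
  by (rule DERIV_chain2[OF DERIV_Phi assms])

text \<open>The density is even, so the sum has derivative zero and is constant; its limit at
  infinity identifies the constant.\<close>

lemma Phi_uminus: "Phi z + Phi (- z) = 1"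
proof -
  have "((\<lambda>u. Phi u + Phi (- u)) has_real_derivative 0) (at u)" for u
    by (auto intro!: derivative_eq_intros)
  then have const: "(\<lambda>u. Phi u + Phi (- u)) = (\<lambda>u. Phi z + Phi (- z))"
    by (intro ext DERIV_isconst_all[of "\<lambda>u. Phi u + Phi (- u)", rule_format])
  have "((\<lambda>u. Phi u + Phi (- u)) \<longlongrightarrow> 1 + 0) at_top"
    by (intro tendsto_add Phi_at_top filterlim_compose[OF Phi_at_bot filterlim_uminus_at_bot_at_top])
  then have "((\<lambda>u::real. Phi z + Phi (- z)) \<longlongrightarrow> 1) at_top"
    by (simp only: const add_0_right)
  then show ?thesis by (simp add: tendsto_const_iff)
qed

lemma Phi_0: "Phi 0 = 1 / 2"
  using Phi_uminus[of 0] by simp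

text \<open>The reflection of \<open>t\<close> to \<open>- t\<close> turns the upper tail in
  \<open>h_kappa\<close> into the same \<open>Phi\<close> term that occurs in
  \<open>g_kappa\<close>.\<close>

lemma gaussian_tail_eq_Phi:
  "(LBINT t:{z..}. exp (- (1 / 2) * t\<^sup>2)) = sqrt (2 * pi) * Phi (- z)"
proof -
  have "(LBINT t:{z..}. exp (- (1 / 2) * t\<^sup>2)) = (LBINT t:{t. - t \<in> {z..}}. exp (- t\<^sup>2 / 2))"
    by (subst set_integral_reflect) simp
  also have "{t. - t \<in> {z..}} = {..- z}" by auto
  finally show ?thesis by (simp add: Phi_def)
qed

section \<open>The functions \<open>g\<close> and \<open>h\<close>\<close>

lemma h_kappa_eq_Phi:
  "h_kappa \<kappa> x = 2 * sqrt (2 * pi) * Phi (- (sqrt (1 / \<kappa>) * (\<kappa> + 1) * x))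
     - sqrt (1 / \<kappa>) * (exp (- ((\<kappa> + 1)\<^sup>2 / (2 * \<kappa>)) * x\<^sup>2) / x)"
  by (simp only: h_kappa_def gaussian_tail_eq_Phi mult.assoc)

lemma exp_square_scaled:
  fixes \<kappa> x :: real
  assumes "\<kappa> > 0"
  shows "exp (- (sqrt (1 / \<kappa>) * c * x)\<^sup>2 / 2) = exp (- (c\<^sup>2 / (2 * \<kappa>)) * x\<^sup>2)"
  using assms by (simp add: power_mult_distrib)

text \<open>Since \<open>(\<kappa> + 1)\<^sup>2 - (\<kappa> - 1)\<^sup>2 = 4 * \<kappa>\<close>, the
  factor \<open>exp (2 * x\<^sup>2)\<close> converts the Gaussian of one \<open>Phi\<close> argument
  in \<open>g_kappa\<close> into that of the other.\<close>

lemma exp_square_shift: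
  fixes \<kappa> x :: real
  assumes "\<kappa> > 0"
  shows "exp (2 * x\<^sup>2) * exp (- ((\<kappa> + 1)\<^sup>2 / (2 * \<kappa>)) * x\<^sup>2)
    = exp (- ((\<kappa> - 1)\<^sup>2 / (2 * \<kappa>)) * x\<^sup>2)"
  unfolding mult_exp_exp using assms by (simp add: field_simps power2_eq_square)

section \<open>Derivatives of \<open>g_kappa\<close> and \<open>h_kappa\<close>, and the limit of
  \<open>h_kappa\<close>\<close>

lemma DERIV_g_kappa:
  assumes \<kappa>: "\<kappa> > 0" and x: "x > 0"
  shows "(g_kappa \<kappa> has_real_derivative 2 * x * exp (2 * x\<^sup>2) / sqrt (2 * pi) * h_kappa \<kappa> x) (at x)"
proof -
  define s where "s = sqrt (1 / \<kappa>)"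
  define P where "P = Phi (- (s * (\<kappa> + 1) * x))"
  define E where "E = exp (- ((\<kappa> + 1)\<^sup>2 / (2 * \<kappa>)) * x\<^sup>2)"
  define F where "F = exp (2 * x\<^sup>2)"
  define q where "q = sqrt (2 * pi)"
  have q: "q > 0" by (simp add: q_def)
  have E1: "exp (- (s * (\<kappa> + 1) * x)\<^sup>2 / 2) = E"
    unfolding s_def E_def by (rule exp_square_scaled[OF \<kappa>])
  have E2: "exp (- (s * (\<kappa> - 1) * x)\<^sup>2 / 2) = F * E"
    unfolding s_def E_def F_def exp_square_shift[OF \<kappa>] by (rule exp_square_scaled[OF \<kappa>])
  have D1: "((\<lambda>x. Phi (s * (\<kappa> - 1) * x)) has_real_derivative F * E / q * (s * (\<kappa> - 1))) (at x)"
    using DERIV_Phi_chain[OF DERIV_cmult_Id, of "s * (\<kappa> - 1)" x] by (simp only: E2 q_def)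
  have D2: "((\<lambda>x. Phi (- (s * (\<kappa> + 1) * x))) has_real_derivative E / q * (- (s * (\<kappa> + 1)))) (at x)"
    using DERIV_Phi_chain[OF DERIV_minus[OF DERIV_cmult_Id], of "s * (\<kappa> + 1)" x]
    by (simp only: E1 q_def power2_minus)
  have D3: "((\<lambda>x. exp (2 * x\<^sup>2)) has_real_derivative F * (4 * x)) (at x)"
    by (auto intro!: derivative_eq_intros simp: F_def)
  have "(g_kappa \<kappa> has_real_derivative
      F * E / q * (s * (\<kappa> - 1)) + (F * (4 * x) * P + E / q * (- (s * (\<kappa> + 1))) * F)) (at x)"
    using DERIV_add[OF D1 DERIV_mult[OF D3 D2]]
    by (simp only: g_kappa_def[abs_def] s_def P_def F_def)
  \<comment> \<open>The two Gaussian terms share \<open>F * E / q\<close>, and their coefficients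
    \<open>s * (\<kappa> - 1)\<close> and \<open>- (s * (\<kappa> + 1))\<close> add up to
    \<open>- 2 * s\<close>.\<close>
  moreover have "F * E / q * (s * (\<kappa> - 1)) + (F * (4 * x) * P + E / q * (- (s * (\<kappa> + 1))) * F)
      = 2 * x * F / q * (2 * q * P - s * (E / x))"
    using x q by (simp add: field_simps)
  ultimately show ?thesis
    by (simp only: h_kappa_eq_Phi s_def P_def E_def F_def q_def)
qed

text \<open>Differentiation removes the integral: every term becomes a multiple of one Gaussian, so
  the sign is that of an elementary factor.\<close>

lemma DERIV_h_kappa:
  assumes \<kappa>: "\<kappa> > 0" and x: "x > 0"
  shows "(h_kappa \<kappa> has_real_derivative
    exp (- ((\<kappa> + 1)\<^sup>2 / (2 * \<kappa>)) * x\<^sup>2) * sqrt (1 / \<kappa>) * (1 / x\<^sup>2 - (\<kappa>\<^sup>2 - 1) / \<kappa>)) (at x)"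
proof -
  define s where "s = sqrt (1 / \<kappa>)"
  define E where "E = exp (- ((\<kappa> + 1)\<^sup>2 / (2 * \<kappa>)) * x\<^sup>2)"
  define q where "q = sqrt (2 * pi)"
  have q: "q > 0" by (simp add: q_def)
  have E1: "exp (- (s * (\<kappa> + 1) * x)\<^sup>2 / 2) = E"
    unfolding s_def E_def by (rule exp_square_scaled[OF \<kappa>])
  have D1: "((\<lambda>x. Phi (- (s * (\<kappa> + 1) * x))) has_real_derivative E / q * (- (s * (\<kappa> + 1)))) (at x)"
    using DERIV_Phi_chain[OF DERIV_minus[OF DERIV_cmult_Id], of "s * (\<kappa> + 1)" x]
    by (simp only: E1 q_def power2_minus)
  have D2: "((\<lambda>x. exp (- ((\<kappa> + 1)\<^sup>2 / (2 * \<kappa>)) * x\<^sup>2)) has_real_derivative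
      E * (- ((\<kappa> + 1)\<^sup>2 / (2 * \<kappa>)) * (2 * x))) (at x)"
    unfolding E_def by (intro DERIV_fun_exp DERIV_cmult) (auto intro!: derivative_eq_intros)
  have "(h_kappa \<kappa> has_real_derivative
      2 * q * (E / q * (- (s * (\<kappa> + 1))))
        - s * ((E * (- ((\<kappa> + 1)\<^sup>2 / (2 * \<kappa>)) * (2 * x)) * x - E * 1) / (x * x))) (at x)"
    using DERIV_diff[OF DERIV_cmult[OF D1] DERIV_cmult[OF DERIV_divide[OF D2 DERIV_ident]], of "2 * q" s] x
    unfolding h_kappa_eq_Phi[abs_def] s_def q_def E_def by simp
  \<comment> \<open>With \<open>E * s\<close> factored out, the terms free of \<open>x\<close> are
    \<open>(\<kappa> + 1)\<^sup>2 / \<kappa> - 2 * (\<kappa> + 1) = - (\<kappa>\<^sup>2 - 1) /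
    \<kappa>\<close>.\<close>
  moreover have "2 * q * (E / q * (- (s * (\<kappa> + 1))))
        - s * ((E * (- ((\<kappa> + 1)\<^sup>2 / (2 * \<kappa>)) * (2 * x)) * x - E * 1) / (x * x))
      = E * s * (1 / x\<^sup>2 - (\<kappa>\<^sup>2 - 1) / \<kappa>)"
    using x q \<kappa> by (simp add: field_simps power2_eq_square)
  ultimately show ?thesis
    by (simp only: s_def E_def)
qed

lemma h_kappa_at_top:
  assumes "\<kappa> > 0"
  shows "(h_kappa \<kappa> \<longlongrightarrow> 0) at_top"
proof -
  have "filterlim (\<lambda>x. - (sqrt (1 / \<kappa>) * (\<kappa> + 1) * x)) at_bot at_top"
    using assms unfolding filterlim_uminus_at_top[symmetric]
    by (intro filterlim_tendsto_pos_mult_at_top[OF tendsto_const] filterlim_ident) auto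
  then have 1: "((\<lambda>x. Phi (- (sqrt (1 / \<kappa>) * (\<kappa> + 1) * x))) \<longlongrightarrow> 0) at_top"
    by (rule filterlim_compose[OF Phi_at_bot])
  have 2: "((\<lambda>x. exp (- ((\<kappa> + 1)\<^sup>2 / (2 * \<kappa>)) * x\<^sup>2) / x) \<longlongrightarrow> 0) at_top"
  proof (rule real_tendsto_sandwich[OF _ _ tendsto_const tendsto_inverse_0_at_top[OF filterlim_ident]])
    show "\<forall>\<^sub>F x in at_top. 0 \<le> exp (- ((\<kappa> + 1)\<^sup>2 / (2 * \<kappa>)) * x\<^sup>2) / x"
      using eventually_gt_at_top[of 0] by eventually_elim auto
    show "\<forall>\<^sub>F x in at_top. exp (- ((\<kappa> + 1)\<^sup>2 / (2 * \<kappa>)) * x\<^sup>2) / x \<le> inverse x"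
      using eventually_gt_at_top[of 0]
      by eventually_elim (use assms in \<open>auto simp: divide_simps\<close>)
  qed
  have "(h_kappa \<kappa> \<longlongrightarrow> 2 * sqrt (2 * pi) * 0 - sqrt (1 / \<kappa>) * 0) at_top"
    unfolding h_kappa_eq_Phi[abs_def] by (intro tendsto_intros 1 2)
  then show ?thesis by simp
qed

section \<open>Negativity of \<open>h_kappa\<close> and the limit of \<open>g_kappa\<close> for
  \<kappa> \<le> 1\<close>

lemma h_kappa_neg_of_le_1:
  assumes "0 < \<kappa>" "\<kappa> \<le> 1" "0 < x"
  shows "h_kappa \<kappa> x < 0"
proof (rule deriv_pos_tendsto_imp_less[OF DERIV_h_kappa _ h_kappa_at_top])
  fix y assume "x < y"
  then have "0 < 1 / y\<^sup>2" using assms by simp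
  moreover have "(\<kappa>\<^sup>2 - 1) / \<kappa> \<le> 0"
    using assms by (simp add: divide_nonpos_pos power_le_one)
  ultimately have "0 < 1 / y\<^sup>2 - (\<kappa>\<^sup>2 - 1) / \<kappa>" by linarith
  then show "0 < exp (- ((\<kappa> + 1)\<^sup>2 / (2 * \<kappa>)) * y\<^sup>2) * sqrt (1 / \<kappa>) * (1 / y\<^sup>2 - (\<kappa>\<^sup>2 - 1) / \<kappa>)"
    using assms by (intro mult_pos_pos) auto
qed (use assms in auto)

lemma g_kappa_at_top:
  assumes \<kappa>: "0 < \<kappa>" "\<kappa> \<le> 1"
  shows "(g_kappa \<kappa> \<longlongrightarrow> (if \<kappa> < 1 then 0 else 1 / 2)) at_top"
proof -
  \<comment> \<open>Solving \<open>h_kappa \<kappa> x < 0\<close> for its \<open>Phi\<close> term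
    gives the bound \<open>C / x\<close> times the Gaussian.\<close>
  define C where "C = sqrt (1 / \<kappa>) / (2 * sqrt (2 * pi))"
  \<comment> \<open>The argument of \<open>Phi\<close> tends to minus infinity for \<kappa> < 1 but
    is constantly zero for \<kappa> = 1, hence the two limits.\<close>
  have 1: "((\<lambda>x. Phi (sqrt (1 / \<kappa>) * (\<kappa> - 1) * x)) \<longlongrightarrow> (if \<kappa> < 1 then 0 else 1 / 2)) at_top"
  proof (cases "\<kappa> < 1")
    case True
    have "filterlim (\<lambda>x. sqrt (1 / \<kappa>) * (\<kappa> - 1) * x) at_bot at_top"
      using True \<kappa>
      by (intro filterlim_tendsto_neg_mult_at_bot[OF tendsto_const] filterlim_ident mult_pos_neg) auto
    then show ?thesis using True by (simp add: filterlim_compose[OF Phi_at_bot])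
  next
    case False
    then show ?thesis using \<kappa> by (simp add: Phi_0)
  qed
  have bound: "exp (2 * x\<^sup>2) * Phi (- (sqrt (1 / \<kappa>) * (\<kappa> + 1) * x)) \<le> C * inverse x"
    if "0 < x" for x
  proof -
    define E where "E = exp (- ((\<kappa> + 1)\<^sup>2 / (2 * \<kappa>)) * x\<^sup>2)"
    define P where "P = Phi (- (sqrt (1 / \<kappa>) * (\<kappa> + 1) * x))"
    have "P \<le> C * inverse x * E"
      using h_kappa_neg_of_le_1[OF \<kappa> that] that
      unfolding h_kappa_eq_Phi C_def E_def[symmetric] P_def[symmetric] by (simp add: field_simps)
    then have "exp (2 * x\<^sup>2) * P \<le> C * inverse x * (exp (2 * x\<^sup>2) * E)"
      by (simp add: mult.left_commute)
    \<comment> \<open>The growing exponential is absorbed: the product is again a Gaussian, with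
      exponent at most zero.\<close>
    also have "exp (2 * x\<^sup>2) * E \<le> 1"
      unfolding E_def exp_square_shift[OF \<kappa>(1)] using \<kappa> by simp
    then have "C * inverse x * (exp (2 * x\<^sup>2) * E) \<le> C * inverse x * 1"
      using \<kappa> that by (intro mult_left_mono) (auto simp: C_def)
    finally show ?thesis by (simp add: P_def)
  qed
  have 2: "((\<lambda>x. exp (2 * x\<^sup>2) * Phi (- (sqrt (1 / \<kappa>) * (\<kappa> + 1) * x))) \<longlongrightarrow> 0) at_top"
  proof (rule real_tendsto_sandwich[OF _ _ tendsto_const])
    show "\<forall>\<^sub>F x in at_top. 0 \<le> exp (2 * x\<^sup>2) * Phi (- (sqrt (1 / \<kappa>) * (\<kappa> + 1) * x))"
      by (simp add: Phi_bounds)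
    show "\<forall>\<^sub>F x in at_top. exp (2 * x\<^sup>2) * Phi (- (sqrt (1 / \<kappa>) * (\<kappa> + 1) * x)) \<le> C * inverse x"
      using eventually_gt_at_top[of 0] by eventually_elim (rule bound)
    show "((\<lambda>x. C * inverse x) \<longlongrightarrow> 0) at_top"
      by (intro tendsto_mult_right_zero tendsto_inverse_0_at_top filterlim_ident)
  qed
  show ?thesis
    using tendsto_add[OF 1 2] by (simp add: g_kappa_def[abs_def])
qed

section \<open>Monotonicity of \<open>g_kappa\<close> from the sign of
  \<open>h_kappa\<close>\<close>

lemma g_kappa_decreasing:
  assumes \<kappa>: "0 < \<kappa>" and "0 < x" "x \<le> y"
    and neg: "\<And>z. x < z \<Longrightarrow> z < y \<Longrightarrow> h_kappa \<kappa> z \<le> 0"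
  shows "g_kappa \<kappa> y \<le> g_kappa \<kappa> x"
proof (rule DERIV_nonpos_imp_decreasing_open[OF \<open>x \<le> y\<close>])
  \<comment> \<open>The factor in front of \<open>h_kappa\<close> is positive for positive
    \<open>z\<close>. Only interior points matter, so a zero of \<open>h_kappa\<close> may be an
    endpoint.\<close>
  show "\<exists>D. (g_kappa \<kappa> has_real_derivative D) (at z) \<and> D \<le> 0" if "x < z" "z < y" for z
    using DERIV_g_kappa[OF \<kappa>, of z] neg[OF that] that \<open>0 < x\<close>
    by (intro exI[of _ "2 * z * exp (2 * z\<^sup>2) / sqrt (2 * pi) * h_kappa \<kappa> z"] conjI
        mult_nonneg_nonpos) auto
  show "continuous_on {x..y} (g_kappa \<kappa>)"
    using \<open>0 < x\<close>
    by (intro continuous_at_imp_continuous_on ballI DERIV_isCont[OF DERIV_g_kappa[OF \<kappa>]]) auto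
qed

lemma g_kappa_increasing:
  assumes \<kappa>: "0 < \<kappa>" and "0 < x" "x \<le> y"
    and pos: "\<And>z. x < z \<Longrightarrow> z < y \<Longrightarrow> 0 \<le> h_kappa \<kappa> z"
  shows "g_kappa \<kappa> x \<le> g_kappa \<kappa> y"
proof (rule DERIV_nonneg_imp_increasing_open[OF \<open>x \<le> y\<close>])
  show "\<exists>D. (g_kappa \<kappa> has_real_derivative D) (at z) \<and> 0 \<le> D" if "x < z" "z < y" for z
    using DERIV_g_kappa[OF \<kappa>, of z] pos[OF that] that \<open>0 < x\<close>
    by (intro exI[of _ "2 * z * exp (2 * z\<^sup>2) / sqrt (2 * pi) * h_kappa \<kappa> z"] conjI
        mult_nonneg_nonneg) auto
  show "continuous_on {x..y} (g_kappa \<kappa>)"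
    using \<open>0 < x\<close>
    by (intro continuous_at_imp_continuous_on ballI DERIV_isCont[OF DERIV_g_kappa[OF \<kappa>]]) auto
qed

section \<open>The sign change of \<open>h_kappa\<close> for \<kappa> > 1\<close>

lemma h_kappa_neg_near_0:
  assumes \<kappa>: "\<kappa> > 0" and "c > 0"
  obtains x where "0 < x" "x < c" "h_kappa \<kappa> x < 0"
proof -
  define s where "s = sqrt (1 / \<kappa>)"
  define m where "m = exp (- ((\<kappa> + 1)\<^sup>2 / (2 * \<kappa>)))"
  define q where "q = sqrt (2 * pi)"
  \<comment> \<open>The bound 1 keeps the Gaussian above its value \<open>m\<close> at 1,
    \<open>c / 2\<close> ensures \<open>x < c\<close>, and the last entry makes the subtracted term
    at least \<open>4 * q\<close>, while the \<open>Phi\<close> term is at most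
    \<open>2 * q\<close>.\<close>
  define x where "x = min (min 1 (c / 2)) (s * m / (4 * q))"
  have pos: "0 < s" "0 < m" "0 < q" using \<kappa> by (simp_all add: s_def m_def q_def)
  have x: "0 < x" "x < c" "x \<le> 1" "x \<le> s * m / (4 * q)"
    using pos \<open>c > 0\<close> by (auto simp: x_def)
  have "m \<le> exp (- ((\<kappa> + 1)\<^sup>2 / (2 * \<kappa>)) * x\<^sup>2)"
    using x \<kappa> mult_left_mono[OF power_le_one[of x 2], of "(\<kappa> + 1)\<^sup>2 / (2 * \<kappa>)"] by (simp add: m_def)
  then have "s * (m / x) \<le> s * (exp (- ((\<kappa> + 1)\<^sup>2 / (2 * \<kappa>)) * x\<^sup>2) / x)"
    using pos x by (intro mult_left_mono divide_right_mono) auto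
  moreover have "4 * q \<le> s * (m / x)"
    using x pos by (simp add: field_simps)
  moreover have "2 * q * Phi (- (s * (\<kappa> + 1) * x)) \<le> 2 * q * 1"
    using pos Phi_bounds by (intro mult_left_mono) auto
  ultimately have "h_kappa \<kappa> x < 0"
    unfolding h_kappa_eq_Phi s_def[symmetric] q_def[symmetric] using pos by linarith
  with x that show thesis by blast
qed

lemma h_kappa_sign_change:
  assumes \<kappa>: "\<kappa> > 1"
  obtains x\<^sub>0 where "0 < x\<^sub>0" "h_kappa \<kappa> x\<^sub>0 = 0"
    and "\<And>x. 0 < x \<Longrightarrow> x < x\<^sub>0 \<Longrightarrow> h_kappa \<kappa> x < 0"
    and "\<And>x. x\<^sub>0 < x \<Longrightarrow> 0 < h_kappa \<kappa> x"
proof -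
  have \<kappa>0: "\<kappa> > 0" using \<kappa> by simp
  define A where "A = (\<kappa>\<^sup>2 - 1) / \<kappa>"
  \<comment> \<open>The critical point of \<open>h_kappa\<close>, where \<open>1 / x\<^sup>2\<close>
    equals \<open>A\<close>.\<close>
  define c where "c = sqrt (1 / A)"
  have A: "A > 0" using \<kappa> by (simp add: A_def)
  have c: "c > 0" and c2: "1 / c\<^sup>2 = A" using A by (simp_all add: c_def)
  define h' where
    "h' x = exp (- ((\<kappa> + 1)\<^sup>2 / (2 * \<kappa>)) * x\<^sup>2) * sqrt (1 / \<kappa>) * (1 / x\<^sup>2 - A)" for x
  have deriv: "(h_kappa \<kappa> has_real_derivative h' x) (at x)" if "0 < x" for x
    using DERIV_h_kappa[OF \<kappa>0 that] by (simp only: h'_def A_def)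
  have h'_pos: "0 < h' x" if "0 < x" "x < c" for x
  proof -
    have "1 / c\<^sup>2 < 1 / x\<^sup>2"
      using that by (intro divide_strict_left_mono power_strict_mono) auto
    then show ?thesis using \<kappa>0 by (simp add: h'_def c2)
  qed
  have h'_neg: "h' x < 0" if "c < x" for x
  proof -
    have "1 / x\<^sup>2 < 1 / c\<^sup>2"
      using that c by (intro divide_strict_left_mono power_strict_mono) auto
    then show ?thesis unfolding c2 h'_def using \<kappa>0 by (intro mult_pos_neg) auto
  qed
  have cont: "continuous_on {x..y} (h_kappa \<kappa>)" if "0 < x" for x y
    using that by (intro continuous_at_imp_continuous_on ballI DERIV_isCont[OF deriv]) auto
  have incr: "h_kappa \<kappa> x < h_kappa \<kappa> y" if "0 < x" "x < y" "y \<le> c" for x y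
    using that
    by (intro DERIV_pos_imp_increasing_open[OF \<open>x < y\<close> _ cont])
      (auto intro!: exI[of _ "h' _"] deriv h'_pos)
  have pos: "0 < h_kappa \<kappa> x" if "c \<le> x" for x
  proof -
    \<comment> \<open>Beyond \<open>c\<close> the negated function increases to zero;
      \<open>x = c\<close> is included although the derivative vanishes there.\<close>
    have "- h_kappa \<kappa> x < - 0"
    proof (rule deriv_pos_tendsto_imp_less[where f = "\<lambda>y. - h_kappa \<kappa> y" and f' = "\<lambda>y. - h' y"])
      show "((\<lambda>y. - h_kappa \<kappa> y) has_real_derivative - h' y) (at y)" if "x \<le> y" for y
        using that \<open>c \<le> x\<close> c by (intro DERIV_minus deriv) auto
      show "0 < - h' y" if "x < y" for y
        using h'_neg[of y] that \<open>c \<le> x\<close> by simp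
      show "((\<lambda>y. - h_kappa \<kappa> y) \<longlongrightarrow> - 0) at_top"
        by (intro tendsto_minus h_kappa_at_top \<kappa>0)
    qed
    then show ?thesis by simp
  qed
  obtain x\<^sub>1 where x1: "0 < x\<^sub>1" "x\<^sub>1 < c" "h_kappa \<kappa> x\<^sub>1 < 0"
    using h_kappa_neg_near_0[OF \<kappa>0 c] .
  obtain x\<^sub>0 where x0: "x\<^sub>1 \<le> x\<^sub>0" "x\<^sub>0 \<le> c" "h_kappa \<kappa> x\<^sub>0 = 0"
    using IVT'[of "h_kappa \<kappa>" x\<^sub>1 0 c, OF _ _ _ cont] x1 pos[of c] by auto
  show thesis
  proof (rule that[of x\<^sub>0])
    \<comment> \<open>Up to \<open>c\<close> strict increase from the zero gives positivity; beyond
      \<open>c\<close> the decay to zero does.\<close>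
    show "0 < h_kappa \<kappa> x" if "x\<^sub>0 < x" for x
      using incr[of x\<^sub>0 x] pos[of x] that x0 x1 by (cases "x \<le> c") auto
  qed (use incr[of _ x\<^sub>0] x0 x1 in auto)
qed

section \<open>The infimum and the minimum of \<open>g_kappa\<close>\<close>

theorem theorem2p1:
  fixes \<kappa> :: real
  assumes "\<kappa> > 0"
  shows "(\<kappa> \<le> 1 \<longrightarrow>
            bdd_below (g_kappa \<kappa> ` {0<..}) \<and>
            (INF x\<in>{0<..}. g_kappa \<kappa> x) = (if \<kappa> < 1 then 0 else 1 / 2) \<and>
            (g_kappa \<kappa> \<longlongrightarrow> (if \<kappa> < 1 then 0 else 1 / 2)) at_top)
       \<and> (\<kappa> > 1 \<longrightarrow>
            (\<exists>!x\<^sub>0. x\<^sub>0 \<in> {0<..} \<and> h_kappa \<kappa> x\<^sub>0 = 0) \<and>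
            (\<forall>x\<^sub>0\<in>{0<..}. h_kappa \<kappa> x\<^sub>0 = 0 \<longrightarrow>
               is_arg_min (g_kappa \<kappa>) (\<lambda>x. x \<in> {0<..}) x\<^sub>0))"
proof (intro conjI[of "_ \<longrightarrow> _"] impI)
  assume le: "\<kappa> \<le> 1"
  have decr: "g_kappa \<kappa> y \<le> g_kappa \<kappa> x" if "0 < x" "x < y" for x y
    using that by (intro g_kappa_decreasing assms less_imp_le[OF h_kappa_neg_of_le_1] le) auto
  note lim = g_kappa_at_top[OF assms le]
  show "bdd_below (g_kappa \<kappa> ` {0<..}) \<and>
      (INF x\<in>{0<..}. g_kappa \<kappa> x) = (if \<kappa> < 1 then 0 else 1 / 2) \<and>
      (g_kappa \<kappa> \<longlongrightarrow> (if \<kappa> < 1 then 0 else 1 / 2)) at_top"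
    by (intro conjI INF_eq_limit_at_top[OF decr lim] lim)
next
  assume "\<kappa> > 1"
  then obtain z where z: "0 < z" "h_kappa \<kappa> z = 0"
    and neg: "\<And>x. 0 < x \<Longrightarrow> x < z \<Longrightarrow> h_kappa \<kappa> x < 0"
    and pos: "\<And>x. z < x \<Longrightarrow> 0 < h_kappa \<kappa> x"
    using h_kappa_sign_change by blast
  have unique: "x = z" if "0 < x" "h_kappa \<kappa> x = 0" for x
    using neg[of x] pos[of x] that by (cases x z rule: linorder_cases) auto
  \<comment> \<open>\<open>g_kappa\<close> decreases up to \<open>z\<close> and increases from there
    on.\<close>
  have "g_kappa \<kappa> z \<le> g_kappa \<kappa> x" if "0 < x" for x
  proof (cases "x \<le> z")
    case True
    then show ?thesis
      using that by (intro g_kappa_decreasing assms less_imp_le[OF neg]) auto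
  next
    case False
    then show ?thesis
      using z by (intro g_kappa_increasing assms less_imp_le[OF pos]) auto
  qed
  then have "is_arg_min (g_kappa \<kappa>) (\<lambda>x. x \<in> {0<..}) z"
    using z by (simp add: is_arg_min_linorder)
  then show "(\<exists>!x\<^sub>0. x\<^sub>0 \<in> {0<..} \<and> h_kappa \<kappa> x\<^sub>0 = 0) \<and>
      (\<forall>x\<^sub>0\<in>{0<..}. h_kappa \<kappa> x\<^sub>0 = 0 \<longrightarrow> is_arg_min (g_kappa \<kappa>) (\<lambda>x. x \<in> {0<..}) x\<^sub>0)"
    using z unique by (metis greaterThan_iff)
qed

end
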